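(* Let $f\in\mathcal{S}^*_B$, let $\Gamma_1,\Gamma_2,\dots$ be the logarithmic coefficients of the inverse function $f^{-1}$, and let $\mathcal{T}_{2,1}(F_{f^{-1}}/2)=\Gamma_1^2-\Gamma_2^2$. Then $$|\mathcal{T}_{2,1}(F_{f^{-1}}/2)|\le\frac{25}{64}.$$ This inequality is sharp, i.e. equality holds for some function in $\mathcal{S}^*_B$.
   Context: Let $\mathbb{D}=\{z\in\mathbb{C}:|z|<1\}$ and let $\mathcal{A}$ be the class of analytic functions $f$ on $\mathbb{D}$ with $f(0)=0$, $f'(0)=1$, written $f(z)=z+\sum_{n=2}^\infty a_nz^n$. For analytic functions $g,h$ on $\mathbb{D}$, $g\prec h$ ($g$ is subordinate to $h$) means $g(z)=h(w(z))$ on $\mathbb{D}$ for some analytic $w:\mathbb{D}\to\mathbb{D}$ with $w(0)=0$. Let $B(z)=\dfrac{1}{1-\log(1+z)}$ on $\mathbb{D}$ (principal branch of the logarithm), and let $$\mathcal{S}^*_B=\left\{f\in\mathcal{A}:\ \frac{zf'(z)}{f(z)}\prec B(z)\right\}.$$ The inverse $f^{-1}$ is the local inverse of $f$ near the origin, and its logarithmic coefficients $\Gamma_n$ are defined by $F_{f^{-1}}(w)=\log\frac{f^{-1}(w)}{w}=2\sum_{n=1}^\infty\Gamma_nw^n$ for $w$ near $0$ (the branch vanishing at $w=0$). Thus $\Gamma_1=-\frac12a_2$ and $\Gamma_2=-\frac12\left(a_3-\frac32a_2^2\right)$. *)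

theory Defs
  imports "HOL-Complex_Analysis.Complex_Analysis"
begin

abbreviation unit_disc :: "complex set" where
  "unit_disc \<equiv> ball 0 1"

definition class_A :: "(complex \<Rightarrow> complex) set" where
  "class_A = {f. f holomorphic_on unit_disc \<and> f 0 = 0 \<and> deriv f 0 = 1}"

definition subordinate :: "(complex \<Rightarrow> complex) \<Rightarrow> (complex \<Rightarrow> complex) \<Rightarrow> bool" where
  "subordinate g h \<longleftrightarrow>
     g holomorphic_on unit_disc \<and> h holomorphic_on unit_disc \<and>
     (\<exists>w. w holomorphic_on unit_disc \<and> w ` unit_disc \<subseteq> unit_disc \<and> w 0 = 0 \<and>
          (\<forall>z\<in>unit_disc. g z = h (w z)))"

definition B_fun :: "complex \<Rightarrow> complex" where
  "B_fun z = 1 / (1 - Ln (1 + z))"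

text \<open>The singularity of \<open>z f'(z) / f(z)\<close> at the origin is removable for \<open>f\<close> in
  \<^const>\<open>class_A\<close>, with value \<open>1\<close>; in HOL the bare quotient would be \<open>0 / 0 = 0\<close> there.\<close>

definition starlike_quotient :: "(complex \<Rightarrow> complex) \<Rightarrow> complex \<Rightarrow> complex" where
  "starlike_quotient f z = (if z = 0 then 1 else z * deriv f z / f z)"

text \<open>The condition \<open>f z \<noteq> 0\<close> off the origin is implicit in the analyticity of the quotient
  (HOL division is total).\<close>

definition starlike_B :: "(complex \<Rightarrow> complex) set" where
  "starlike_B = {f \<in> class_A. (\<forall>z\<in>unit_disc - {0}. f z \<noteq> 0) \<and>
                              subordinate (starlike_quotient f) B_fun}"

text \<open>A local inverse at the origin exists for \<open>f\<close> in \<^const>\<open>class_A\<close> and is unique as a germ;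
  everything below depends only on its germ at \<open>0\<close>.\<close>

definition is_local_inverse :: "(complex \<Rightarrow> complex) \<Rightarrow> (complex \<Rightarrow> complex) \<Rightarrow> bool" where
  "is_local_inverse f g \<longleftrightarrow>
     g analytic_on {0} \<and> g 0 = 0 \<and> (\<forall>\<^sub>F w in nhds 0. f (g w) = w)"

definition local_inverse :: "(complex \<Rightarrow> complex) \<Rightarrow> complex \<Rightarrow> complex" where
  "local_inverse f = (SOME g. is_local_inverse f g)"

text \<open>For \<open>g = local_inverse f\<close> one has \<open>g(w)/w \<longlongrightarrow> 1\<close> as \<open>w \<longlongrightarrow> 0\<close>, so near \<open>0\<close> the branch of
  \<open>log (g(w)/w)\<close> vanishing at \<open>0\<close> is the principal one.\<close>

definition log_fun :: "(complex \<Rightarrow> complex) \<Rightarrow> complex \<Rightarrow> complex" where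
  "log_fun g w = (if w = 0 then 0 else Ln (g w / w))"

definition inverse_log_coeff :: "(complex \<Rightarrow> complex) \<Rightarrow> nat \<Rightarrow> complex" where
  "inverse_log_coeff f n = fps_nth (fps_expansion (log_fun (local_inverse f)) 0) n / 2"

definition toeplitz_2_1 :: "(nat \<Rightarrow> complex) \<Rightarrow> complex" where
  "toeplitz_2_1 \<Gamma> = (\<Gamma> 1)\<^sup>2 - (\<Gamma> 2)\<^sup>2"

end

(* Write z f'(z) / f(z) = p(z) = B(w(z)) with a Schwarz function w = c z + d z^2 + ... .
   For g = f^{-1}, differentiating f(g(u)) = u gives p(g(u)) u g'(u) = g(u); writing g(u) = u exp(l(u))
   and comparing coefficients, l = - p_1 u + (p_1^2 - p_2 / 2) u^2 + ... .  As B = 1 + z + z^2/2 + ...,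
   this is Gamma_1 = - c / 2 and Gamma_2 = 3 c^2 / 8 - d / 4.  The bound |d| <= 1 - |c|^2 yields
   |Gamma_1|^2 + |Gamma_2|^2 <= 1/4 + 9/64 = 25/64, and w(z) = i z, for which Gamma_1^2 and Gamma_2^2
   have opposite signs, attains it. *)
theory Submission
  imports Defs
begin

section \<open>Low-order coefficients of composed power series\<close>

lemma fps_compose_nth_1:
  fixes F G :: "'a::comm_ring_1 fps"
  assumes "fps_nth G 0 = 0"
  shows "fps_nth (F oo G) 1 = fps_nth F 1 * fps_nth G 1"
  using assms by (simp add: fps_compose_nth)

lemma fps_compose_nth_2:
  fixes F G :: "'a::comm_ring_1 fps"
  assumes "fps_nth G 0 = 0"
  shows "fps_nth (F oo G) 2 = fps_nth F 1 * fps_nth G 2 + fps_nth F 2 * (fps_nth G 1)\<^sup>2"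
  using assms by (simp add: fps_compose_nth fps_mult_nth power2_eq_square numeral_2_eq_2)

section \<open>The function \<open>B_fun\<close> and its Taylor coefficients up to order two\<close>

lemma one_plus_not_nonpos_Reals:
  fixes z :: complex
  assumes "norm z < 1"
  shows "1 + z \<notin> \<real>\<^sub>\<le>\<^sub>0"
proof
  assume "1 + z \<in> \<real>\<^sub>\<le>\<^sub>0"
  then have "Re z \<le> -1"
    by (auto simp: complex_nonpos_Reals_iff)
  then show False
    using assms abs_Re_le_cmod[of z] by linarith
qed

text \<open>Otherwise z = e - 1, which has modulus at least 1. This keeps the denominator of
  \<open>B_fun\<close> away from zero on the disc.\<close>

lemma Ln_one_plus_neq_1:
  assumes "norm z < 1"
  shows "Ln (1 + z) \<noteq> 1"
proof
  assume "Ln (1 + z) = 1"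
  moreover have "1 + z \<noteq> 0"
    using one_plus_not_nonpos_Reals[OF assms] by auto
  ultimately have "1 + z = exp 1"
    by (metis exp_Ln)
  then have "z = of_real (exp 1 - 1)"
    by (simp add: exp_of_real[symmetric] algebra_simps)
  then have "norm z = \<bar>exp 1 - 1 :: real\<bar>"
    by (metis norm_of_real)
  then show False
    using assms exp_ge_add_one_self[of 1] by linarith
qed

lemma B_fun_holomorphic: "B_fun holomorphic_on unit_disc"
  unfolding B_fun_def
  by (intro holomorphic_intros) (auto simp: one_plus_not_nonpos_Reals Ln_one_plus_neq_1)

text \<open>Expressing the derivative through \<open>B_fun\<close> itself makes it a quadratic
  differential equation, so the Taylor coefficients follow by recursion without iterated
  differentiation.\<close>

lemma B_fun_has_deriv:
  assumes "norm z < 1"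
  shows "(B_fun has_field_derivative (B_fun z)\<^sup>2 / (1 + z)) (at z)"
proof -
  have "1 + z \<noteq> 0"
    using one_plus_not_nonpos_Reals[OF assms] by auto
  then show ?thesis
    unfolding B_fun_def [abs_def]
    by (auto intro!: derivative_eq_intros
        simp: Ln_one_plus_neq_1[OF assms] one_plus_not_nonpos_Reals[OF assms] power2_eq_square field_simps)
qed

lemma B_fun_expansion:
  obtains F where "B_fun has_fps_expansion F"
    and "fps_nth F 0 = 1" "fps_nth F 1 = 1" "fps_nth F 2 = 1 / 2"
proof -
  define F where "F = fps_expansion B_fun 0"
  have F: "B_fun has_fps_expansion F"
    unfolding F_def by (rule has_fps_expansion_fps_expansion[OF _ _ B_fun_holomorphic]) auto
  \<comment> \<open>The coefficients are read off from \<open>(1 + z) B' = B\<^sup>2\<close>.\<close>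
  have "(\<lambda>z. deriv B_fun z * (1 + z)) has_fps_expansion fps_deriv F * (1 + fps_X)"
    by (intro fps_expansion_intros F)
  moreover have "\<forall>\<^sub>F z in nhds 0. deriv B_fun z * (1 + z) = (B_fun z)\<^sup>2"
  proof -
    have "\<forall>\<^sub>F z in nhds (0::complex). z \<in> unit_disc"
      by (intro eventually_nhds_in_open) auto
    then show ?thesis
    proof eventually_elim
      case (elim z)
      then have "1 + z \<noteq> 0"
        using one_plus_not_nonpos_Reals[of z] by auto
      then show ?case
        using DERIV_imp_deriv[OF B_fun_has_deriv[of z]] elim by simp
    qed
  qed
  ultimately have "(\<lambda>z. (B_fun z)\<^sup>2) has_fps_expansion fps_deriv F * (1 + fps_X)"
    using has_fps_expansion_cong[OF _ refl] by fast
  moreover have "(\<lambda>z. (B_fun z)\<^sup>2) has_fps_expansion F\<^sup>2"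
    by (intro fps_expansion_intros F)
  ultimately have ode: "fps_deriv F * (1 + fps_X) = F * F"
    by (metis fps_expansion_unique_complex power2_eq_square)
  have F0: "fps_nth F 0 = 1"
    using has_fps_expansion_imp_0_eq_fps_nth_0[OF F] by (simp add: B_fun_def)
  have F1: "fps_nth F 1 = 1"
    using arg_cong[OF ode, of "\<lambda>P. fps_nth P 0"] F0 by simp
  have "fps_nth F 2 = 1 / 2"
    using arg_cong[OF ode, of "\<lambda>P. fps_nth P 1"] F0 F1
    by (simp add: fps_mult_nth numeral_2_eq_2 field_simps)
  with F F0 F1 show thesis
    by (rule that)
qed

section \<open>Coefficient bounds for Schwarz functions\<close>

text \<open>This is the Schwarz-Pick inequality at the origin for the function w(z)/z, extended over
  0: its value there is the first coefficient of w and its derivative there is the second.\<close>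

lemma schwarz_second_coeff:
  assumes hol: "w holomorphic_on unit_disc" and im: "w ` unit_disc \<subseteq> unit_disc" and w0: "w 0 = 0"
    and W: "w has_fps_expansion W"
  shows "norm (fps_nth W 1) \<le> 1" "norm (fps_nth W 2) \<le> 1 - (norm (fps_nth W 1))\<^sup>2"
proof -
  define c where "c = fps_nth W 1"
  have no: "norm (w z) < 1" if "norm z < 1" for z
    using im that by (auto simp: image_subset_iff)
  have c: "deriv w 0 = c"
    unfolding c_def using fps_nth_fps_expansion[OF W, of 1] by simp
  have Schwarz: "\<And>z. norm z < 1 \<Longrightarrow> norm (w z) \<le> norm z" "norm (deriv w 0) \<le> 1"
    "(\<exists>z. norm z < 1 \<and> z \<noteq> 0 \<and> norm (w z) = norm z) \<or> norm (deriv w 0) = 1 \<Longrightarrow>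
     \<exists>\<alpha>. (\<forall>z. norm z < 1 \<longrightarrow> w z = \<alpha> * z) \<and> norm \<alpha> = 1"
    using Schwarz_Lemma'[OF hol w0 no] by blast+
  show c1: "norm (fps_nth W 1) \<le> 1"
    using Schwarz(2) c c_def by simp
  show "norm (fps_nth W 2) \<le> 1 - (norm (fps_nth W 1))\<^sup>2"
  \<comment> \<open>For a rotation, w(z)/z is a constant of modulus 1, no longer a map into the open
    disc; there the claim reads 0 \<le> 0. In all other cases the equality clause of the Schwarz
    lemma gives strict inequalities, so w(z)/z maps the disc into itself.\<close>
  proof (cases "\<exists>\<alpha>. (\<forall>z. norm z < 1 \<longrightarrow> w z = \<alpha> * z) \<and> norm \<alpha> = 1")
    case True
    then obtain \<alpha> where \<alpha>: "\<And>z. norm z < 1 \<Longrightarrow> w z = \<alpha> * z" "norm \<alpha> = 1"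
      by blast
    have "\<forall>\<^sub>F z in nhds (0::complex). z \<in> unit_disc"
      by (intro eventually_nhds_in_open) auto
    then have "\<forall>\<^sub>F z in nhds 0. \<alpha> * z = w z"
      by eventually_elim (use \<alpha> in auto)
    moreover have "(\<lambda>z. \<alpha> * z) has_fps_expansion fps_const \<alpha> * fps_X"
      by (intro fps_expansion_intros)
    ultimately have "w has_fps_expansion fps_const \<alpha> * fps_X"
      using has_fps_expansion_cong[OF _ refl] by blast
    then have "W = fps_const \<alpha> * fps_X"
      by (rule fps_expansion_unique_complex[OF W])
    then show ?thesis
      using \<alpha>(2) by simp
  next
    case False
    have lt: "norm (w z) < norm z" if "norm z < 1" "z \<noteq> 0" for z
      using Schwarz(1)[OF that(1)] Schwarz(3) False that by force
    have clt: "norm c < 1"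
      using Schwarz(2,3) False c by force
    \<comment> \<open>Moving \<open>\<phi> 0 = c\<close> to the origin by a Moebius map makes the Schwarz lemma applicable again.\<close>
    define \<phi> where "\<phi> = (\<lambda>z. if z = 0 then c else w z / z)"
    have W0: "fps_nth W 0 = 0"
      using has_fps_expansion_imp_0_eq_fps_nth_0[OF W] w0 by simp
    have \<phi>hol: "\<phi> holomorphic_on unit_disc"
      by (rule pole_theorem_open_0[OF hol, of 0]) (auto simp: \<phi>_def c w0)
    have \<phi>no: "norm (\<phi> z) < 1" if "norm z < 1" for z
      using lt[OF that] clt by (auto simp: \<phi>_def norm_divide)
    \<comment> \<open>Shifting the series by 1 requires subdegree at least 1. The zero series has
      subdegree 0 by convention, hence the separate case \<open>W = 0\<close>.\<close>
    have "(\<lambda>z. if z = 0 then c else w z / z ^ 1) has_fps_expansion fps_shift 1 W"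
    proof (cases "W = 0")
      case True
      then show ?thesis
        using W unfolding c_def
        by (auto simp: has_fps_expansion_0_iff elim!: eventually_mono)
    next
      case False
      then show ?thesis
        using W W0 by (intro has_fps_expansion_shift subdegree_geI) (auto simp: c_def)
    qed
    then have \<phi>exp: "\<phi> has_fps_expansion fps_shift 1 W"
      by (simp only: \<phi>_def power_one_right)
    have d\<phi>: "deriv \<phi> 0 = fps_nth W 2"
      using fps_nth_fps_expansion[OF \<phi>exp, of 1] by (simp add: numeral_2_eq_2)
    define \<psi> where "\<psi> = Moebius_function 0 c \<circ> \<phi>"
    have "\<psi> holomorphic_on unit_disc"
      unfolding \<psi>_def
      by (rule holomorphic_on_compose_gen[OF \<phi>hol Moebius_function_holomorphic[OF clt]])
        (use \<phi>no in auto)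
    moreover have "\<psi> 0 = 0"
      by (simp add: \<psi>_def \<phi>_def Moebius_function_eq_zero)
    moreover have "norm (\<psi> z) < 1" if "norm z < 1" for z
      using \<phi>no[OF that] Moebius_function_norm_lt_1[OF clt] by (simp add: \<psi>_def)
    ultimately
    have "norm (deriv \<psi> 0) \<le> 1"
      using Schwarz_Lemma' by blast
    \<comment> \<open>The Moebius map u -> (u - c) / (1 - cnj c * u) has derivative 1 / (1 - |c|^2)
      at u = c, because the term of the quotient rule containing u - c vanishes there.\<close>
    moreover have "deriv \<psi> 0 = fps_nth W 2 / (1 - cnj c * c)"
    proof (rule DERIV_imp_deriv)
      have nz: "1 - cnj c * c \<noteq> 0"
        using clt complex_norm_square[of c] 
        by (metis abs_square_less_1 abs_norm_cancel mult.commute of_real_eq_1_iff order_less_irrefl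
            right_minus_eq)
      have \<phi>d: "(\<phi> has_field_derivative fps_nth W 2) (at 0)"
        using holomorphic_derivI[OF \<phi>hol, of 0] d\<phi> by simp
      have "((\<lambda>z. (\<phi> z - c) / (1 - cnj c * \<phi> z)) has_field_derivative
             fps_nth W 2 / (1 - cnj c * c)) (at 0)"
        by (rule derivative_eq_intros \<phi>d refl | use nz in \<open>simp add: \<phi>_def\<close>)+
      then show "(\<psi> has_field_derivative fps_nth W 2 / (1 - cnj c * c)) (at 0)"
        by (simp add: \<psi>_def Moebius_function_simple o_def)
    qed
    moreover have "norm (1 - cnj c * c) = 1 - (norm c)\<^sup>2"
    proof -
      have "1 - cnj c * c = of_real (1 - (norm c)\<^sup>2)"
        using complex_norm_square[of c] by (simp add: mult.commute)
      then have "norm (1 - cnj c * c) = \<bar>1 - (norm c)\<^sup>2\<bar>"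
        by (metis norm_of_real)
      then show ?thesis
        using clt by (simp add: abs_square_le_1)
    qed
    moreover have "(norm c)\<^sup>2 < 1"
      using clt by (simp add: abs_square_less_1)
    ultimately have "norm (fps_nth W 2) / (1 - (norm c)\<^sup>2) \<le> 1" "0 < 1 - (norm c)\<^sup>2"
      by (auto simp: norm_divide)
    then show ?thesis
      unfolding c_def by (simp only: pos_divide_le_eq mult_1)
  qed
qed

section \<open>The local inverse and its logarithmic coefficients\<close>

text \<open>As f'(0) = 1 is nonzero, f is injective on a small ball; its holomorphic inverse there
  is a witness for the choice operator in \<open>local_inverse\<close>.\<close>

lemma local_inverse_exists:
  assumes f: "f \<in> class_A"
  shows "is_local_inverse f (local_inverse f)"
proof -
  have hol: "f holomorphic_on unit_disc" and f0: "f 0 = 0" and f1: "deriv f 0 = 1"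
    using f by (auto simp: class_A_def)
  obtain r where r: "r > 0" "ball 0 r \<subseteq> unit_disc" "inj_on f (ball 0 r)"
    by (rule has_complex_derivative_locally_injective[OF hol, of 0]) (auto simp: f1)
  have holr: "f holomorphic_on ball 0 r"
    using hol r(2) holomorphic_on_subset by blast
  obtain g where g: "g holomorphic_on f ` ball 0 r" "\<And>z. z \<in> ball 0 r \<Longrightarrow> g (f z) = z"
    by (rule holomorphic_has_inverse[OF holr _ r(3)]) auto
  \<comment> \<open>Openness of the image makes it a neighbourhood of 0, so that f(g(w)) = w holds
    for all w near 0.\<close>
  have op: "open (f ` ball 0 r)"
    by (rule open_mapping_thm3[OF holr _ r(3)]) auto
  have mem: "0 \<in> f ` ball 0 r"
    using r(1) f0 by (metis centre_in_ball imageI)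
  have "is_local_inverse f g"
    unfolding is_local_inverse_def
  proof (intro conjI)
    show "g analytic_on {0}"
      using g(1) op mem analytic_at by blast
    show "g 0 = 0"
      using g(2)[of 0] r(1) f0 by simp
    show "\<forall>\<^sub>F w in nhds 0. f (g w) = w"
      using eventually_nhds_in_open[OF op mem] by eventually_elim (use g(2) in auto)
  qed
  then show ?thesis
    unfolding local_inverse_def by (metis someI)
qed

text \<open>Two identities between germs are transferred to formal power series:
  \<open>inv_ode\<close> determines the coefficients of g(w)/w from those of \<open>P\<close>, and
  \<open>log_ode\<close> passes from g(w)/w to its logarithm. Comparing low-order coefficients in
  both gives the formulas.\<close>

lemma inverse_log_coeffs:
  assumes f: "f \<in> class_A" and P: "starlike_quotient f has_fps_expansion P"
  shows "inverse_log_coeff f 1 = - fps_nth P 1 / 2"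
    and "inverse_log_coeff f 2 = (fps_nth P 1)\<^sup>2 / 2 - fps_nth P 2 / 4"
proof -
  have hol: "f holomorphic_on unit_disc"
    using f by (auto simp: class_A_def)
  define g where "g = local_inverse f"
  have an: "g analytic_on {0}" and g0: "g 0 = 0" and fg: "\<forall>\<^sub>F w in nhds 0. f (g w) = w"
    using local_inverse_exists[OF f] by (auto simp: g_def is_local_inverse_def)
  define G where "G = fps_expansion g 0"
  have G: "g has_fps_expansion G"
    unfolding G_def by (rule analytic_at_imp_has_fps_expansion_0[OF an])
  have G0: "fps_nth G 0 = 0"
    using has_fps_expansion_imp_0_eq_fps_nth_0[OF G] g0 by simp
  obtain S where S: "open S" "0 \<in> S" "g holomorphic_on S"
    using an analytic_at by blast
  have "isCont g 0"
    using has_fps_expansion_imp_continuous[OF G, of UNIV] by simp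
  then have "(g \<longlongrightarrow> g 0) (nhds 0)"
    by (simp add: continuous_at tendsto_at_iff_tendsto_nhds)
  then have gball: "\<forall>\<^sub>F w in nhds 0. g w \<in> unit_disc"
    by (rule topological_tendstoD) (auto simp: g0)
  \<comment> \<open>Differentiating f(g(w)) = w at a point needs the identity on a whole
    neighbourhood of that point, which \<open>eventually_eventually\<close> provides.\<close>
  have dfg: "\<forall>\<^sub>F w in nhds 0. deriv f (g w) * deriv g w = 1"
    using fg[THEN iffD2[OF eventually_eventually]] gball eventually_nhds_in_open[OF S(1,2)]
  proof (eventually_elim)
    case (elim w)
    have "(f has_field_derivative deriv f (g w)) (at (g w))"
      using holomorphic_derivI[OF hol _ elim(2)] by simp
    moreover have "(g has_field_derivative deriv g w) (at w)"
      using holomorphic_derivI[OF S(3,1) elim(3)] by simp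
    ultimately have "((\<lambda>w. f (g w)) has_field_derivative deriv f (g w) * deriv g w) (at w)"
      by (rule DERIV_chain2)
    then have "((\<lambda>w. w) has_field_derivative deriv f (g w) * deriv g w) (at w)"
      using DERIV_cong_ev[OF refl elim(1) refl] by blast
    then show ?case
      using DERIV_ident DERIV_unique by blast
  qed
  have "deriv g 0 = 1"
    using eventually_nhds_x_imp_x[OF dfg] g0 f by (simp add: class_A_def)
  then have G1: "fps_nth G 1 = 1"
    using fps_nth_fps_expansion[OF G, of 1] by simp
  define H where "H = fps_shift 1 G"
  have GH: "G = fps_X * H"
    unfolding H_def using G0 by (simp add: fps_eq_iff)
  have H0: "fps_nth H 0 = 1"
    using G1 by (simp add: H_def)
  define q where "q = (\<lambda>w. if w = 0 then 1 else g w / w)"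
  have "(\<lambda>w. if w = 0 then 1 else g w / w ^ 1) has_fps_expansion fps_shift 1 G"
    using G G0 G1 by (intro has_fps_expansion_shift subdegree_geI) auto
  then have H: "q has_fps_expansion H"
    by (simp only: q_def H_def power_one_right)
  define l where "l = log_fun g"
  \<comment> \<open>At w = 0 the values agree since Ln 1 = 0.\<close>
  have l: "l = (\<lambda>w. Ln (q w))"
    by (auto simp: l_def log_fun_def q_def)
  have qan: "q analytic_on {0}"
    by (rule has_fps_expansion_imp_analytic_0[OF H])
  have lan: "l analytic_on {0}"
    unfolding l by (intro analytic_intros qan) (simp add: q_def)
  define L where "L = fps_expansion l 0"
  have L: "l has_fps_expansion L"
    unfolding L_def by (rule analytic_at_imp_has_fps_expansion_0[OF lan])
  obtain T where T: "open T" "0 \<in> T" "l holomorphic_on T"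
    using lan analytic_at by blast
  have "isCont q 0"
    using has_fps_expansion_imp_continuous[OF H, of UNIV] by simp
  then have "(q \<longlongrightarrow> q 0) (nhds 0)"
    by (simp add: continuous_at tendsto_at_iff_tendsto_nhds)
  then have qnz: "\<forall>\<^sub>F w in nhds 0. q w \<in> - {0}"
    by (rule topological_tendstoD) (auto simp: q_def)
  then have expl: "\<forall>\<^sub>F w in nhds 0. q w = exp (l w)"
    by eventually_elim (auto simp: l)
  \<comment> \<open>Differentiating q = exp(l) replaces the logarithm by a relation linear in the
    derivative of l, so no expansion of \<open>Ln\<close> has to be composed.\<close>
  have "\<forall>\<^sub>F w in nhds 0. deriv q w = deriv l w * q w"
    using expl[THEN iffD2[OF eventually_eventually]] eventually_nhds_in_open[OF T(1,2)]
  proof eventually_elim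
    case (elim w)
    have "(l has_field_derivative deriv l w) (at w)"
      using holomorphic_derivI[OF T(3,1) elim(2)] by simp
    then have "((\<lambda>w. exp (l w)) has_field_derivative exp (l w) * deriv l w) (at w)"
      by (rule DERIV_chain2[OF DERIV_exp])
    then have "(q has_field_derivative exp (l w) * deriv l w) (at w)"
      using DERIV_cong_ev[OF refl elim(1) refl] by blast
    then show ?case
      using eventually_nhds_x_imp_x[OF elim(1)] by (simp add: DERIV_imp_deriv mult.commute)
  qed
  moreover have "(\<lambda>w. deriv l w * q w) has_fps_expansion fps_deriv L * H"
    by (intro fps_expansion_intros L H)
  ultimately have "deriv q has_fps_expansion fps_deriv L * H"
    by (rule iffD2[OF has_fps_expansion_cong[OF _ refl]])
  then have log_ode: "fps_deriv H = fps_deriv L * H"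
    by (rule fps_expansion_unique_complex[OF has_fps_expansion_deriv[OF H]])
  \<comment> \<open>At z = g(w) the quotient is g(w) f'(g(w)) / w, and f'(g(w)) g'(w) = 1.
    Multiplying out also covers g(w) = 0, where w = f(0) = 0 and both sides vanish.\<close>
  have "\<forall>\<^sub>F w in nhds 0. (starlike_quotient f \<circ> g) w * (w * deriv g w) = g w"
    using dfg fg
  proof eventually_elim
    case (elim w)
    show ?case
    proof (cases "g w = 0")
      case True
      then show ?thesis
        using elim f by (auto simp: class_A_def)
    next
      case False
      then show ?thesis
        using elim g0 by (auto simp: starlike_quotient_def field_simps)
    qed
  qed
  moreover have "(\<lambda>w. (starlike_quotient f \<circ> g) w * (w * deriv g w))
                   has_fps_expansion (P oo G) * (fps_X * fps_deriv G)"
    by (intro fps_expansion_intros P G G0)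
  ultimately have "g has_fps_expansion (P oo G) * (fps_X * fps_deriv G)"
    by (rule iffD1[OF has_fps_expansion_cong[OF _ refl]])
  then have "G = (P oo G) * (fps_X * fps_deriv G)"
    by (rule fps_expansion_unique_complex[OF G])
  then have "fps_X * H = fps_X * ((P oo G) * fps_deriv G)"
    using GH by (simp add: mult_ac)
  then have inv_ode: "H = (P oo G) * fps_deriv G"
    by simp
  have P0: "fps_nth P 0 = 1"
    using has_fps_expansion_imp_0_eq_fps_nth_0[OF P] by (simp add: starlike_quotient_def)
  define h1 h2 where "h1 = fps_nth H 1" and "h2 = fps_nth H 2"
  have G2: "fps_nth G 2 = h1" and G3: "fps_nth G 3 = h2"
    by (simp_all add: h1_def h2_def H_def numeral_2_eq_2 numeral_3_eq_3)
  have C0: "fps_nth (P oo G) 0 = 1"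
    using P0 by simp
  have C1: "fps_nth (P oo G) 1 = fps_nth P 1"
    using fps_compose_nth_1[OF G0, of P] G1 by simp
  have C2: "fps_nth (P oo G) 2 = fps_nth P 1 * h1 + fps_nth P 2"
    using fps_compose_nth_2[OF G0, of P] G1 G2 by simp
  have D: "fps_nth (fps_deriv G) 0 = 1" "fps_nth (fps_deriv G) 1 = 2 * h1"
    "fps_nth (fps_deriv G) 2 = 3 * h2"
    using G1 G2 G3 by (simp_all add: numeral_2_eq_2 numeral_3_eq_3)
  have "h1 = fps_nth ((P oo G) * fps_deriv G) 1"
    unfolding h1_def by (subst inv_ode) simp
  then have h1: "h1 = - fps_nth P 1"
    using C0 C1 D unfolding fps_mult_nth_1 by (simp add: algebra_simps)
  have "h2 = fps_nth ((P oo G) * fps_deriv G) 2"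
    unfolding h2_def by (subst inv_ode) simp
  \<comment> \<open>The unknown \<open>h2\<close> returns with factor 3 because it is the third
    coefficient of \<open>G\<close>; the equation is then solved for it.\<close>
  also have "\<dots> = 3 * h2 + fps_nth P 1 * (2 * h1) + (fps_nth P 1 * h1 + fps_nth P 2)"
    using C0 C1 C2 D by (simp add: fps_mult_nth numeral_2_eq_2)
  finally have h2: "h2 = (3 * (fps_nth P 1)\<^sup>2 - fps_nth P 2) / 2"
    by (simp add: h1 power2_eq_square algebra_simps)
  have L1: "fps_nth L 1 = h1"
    using arg_cong[OF log_ode, of "\<lambda>Q. fps_nth Q 0"] H0 by (simp add: h1_def)
  have "2 * h2 = 2 * fps_nth L 2 + fps_nth L 1 * h1"
    using arg_cong[OF log_ode, of "\<lambda>Q. fps_nth Q 1"] H0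
    by (simp add: h1_def h2_def fps_mult_nth numeral_2_eq_2)
  then have "fps_nth L 2 = (2 * h2 - h1 * h1) / 2"
    unfolding L1 by simp
  then have L2: "fps_nth L 2 = (fps_nth P 1)\<^sup>2 - fps_nth P 2 / 2"
    by (simp add: h1 h2 power2_eq_square diff_divide_distrib)
  show "inverse_log_coeff f 1 = - fps_nth P 1 / 2"
    using L1 h1 by (simp add: inverse_log_coeff_def L_def l_def g_def)
  show "inverse_log_coeff f 2 = (fps_nth P 1)\<^sup>2 / 2 - fps_nth P 2 / 4"
    using L2 by (simp add: inverse_log_coeff_def L_def l_def g_def field_simps)
qed

section \<open>The Toeplitz determinant: sharp bound and extremal function\<close>

text \<open>If w = c z + d z^2 + ..., then B(w(z)) has coefficients p_1 = c and p_2 = d + c^2/2,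
  which are inserted into \<open>inverse_log_coeffs\<close>. Both the upper bound and the extremal
  value are computed from this formula.\<close>

lemma toeplitz_starlike_B:
  assumes f: "f \<in> class_A"
    and w: "w has_fps_expansion W" "w 0 = 0"
    and eq: "\<And>z. z \<in> unit_disc \<Longrightarrow> starlike_quotient f z = B_fun (w z)"
  shows "toeplitz_2_1 (inverse_log_coeff f) =
    (fps_nth W 1 / 2)\<^sup>2 - (3 / 8 * (fps_nth W 1)\<^sup>2 - fps_nth W 2 / 4)\<^sup>2"
proof -
  obtain F where F: "B_fun has_fps_expansion F" "fps_nth F 0 = 1" "fps_nth F 1 = 1" "fps_nth F 2 = 1 / 2"
    by (rule B_fun_expansion)
  have W0: "fps_nth W 0 = 0"
    using has_fps_expansion_imp_0_eq_fps_nth_0[OF w(1)] w(2) by simp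
  have "(B_fun \<circ> w) has_fps_expansion (F oo W)"
    by (rule has_fps_expansion_compose[OF F(1) w(1) W0])
  moreover have "\<forall>\<^sub>F z in nhds 0. (B_fun \<circ> w) z = starlike_quotient f z"
    using eventually_nhds_in_open[of unit_disc 0] by (auto simp: eq elim!: eventually_mono)
  ultimately have P: "starlike_quotient f has_fps_expansion (F oo W)"
    using has_fps_expansion_cong[OF _ refl] by blast
  show ?thesis
    unfolding toeplitz_2_1_def inverse_log_coeffs[OF f P] fps_compose_nth_1[OF W0] fps_compose_nth_2[OF W0] F
    by (simp add: field_simps power2_eq_square)
qed

lemma toeplitz_bound:
  assumes "f \<in> starlike_B"
  shows "norm (toeplitz_2_1 (inverse_log_coeff f)) \<le> 25 / 64"
proof -
  obtain w where w: "w holomorphic_on unit_disc" "w ` unit_disc \<subseteq> unit_disc" "w 0 = 0"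
    "\<And>z. z \<in> unit_disc \<Longrightarrow> starlike_quotient f z = B_fun (w z)"
    using assms by (auto simp: starlike_B_def subordinate_def)
  have f: "f \<in> class_A"
    using assms by (simp add: starlike_B_def)
  define W where "W = fps_expansion w 0"
  have W: "w has_fps_expansion W"
    unfolding W_def by (rule has_fps_expansion_fps_expansion[OF _ _ w(1)]) auto
  define c d where "c = fps_nth W 1" and "d = fps_nth W 2"
  define t where "t = (norm c)\<^sup>2"
  have t: "0 \<le> t" "t \<le> 1" and d: "norm d \<le> 1 - t"
    using schwarz_second_coeff[OF w(1-3) W] by (auto simp: t_def c_def d_def abs_square_le_1)
  have "norm (3 / 8 * c\<^sup>2 - d / 4) \<le> norm (3 / 8 * c\<^sup>2) + norm (d / 4)"
    by (rule norm_triangle_ineq4)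
  also have "\<dots> = 3 / 8 * t + norm d / 4"
    by (simp add: norm_mult norm_divide norm_power t_def)
  \<comment> \<open>Inserting |d| \<le> 1 - t gives 1/4 + t/8, which is largest at t = 1.\<close>
  also have "\<dots> \<le> 3 / 8"
    using d t by simp
  finally have "(norm (3 / 8 * c\<^sup>2 - d / 4))\<^sup>2 \<le> (3 / 8)\<^sup>2"
    by (rule power_mono) simp
  moreover have "norm ((c / 2)\<^sup>2) \<le> 1 / 4"
    using t by (simp add: norm_power norm_divide power_divide t_def)
  ultimately have "norm ((c / 2)\<^sup>2) + norm ((3 / 8 * c\<^sup>2 - d / 4)\<^sup>2) \<le> 25 / 64"
    unfolding norm_power by (simp add: power2_eq_square)
  moreover have "toeplitz_2_1 (inverse_log_coeff f) = (c / 2)\<^sup>2 - (3 / 8 * c\<^sup>2 - d / 4)\<^sup>2"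
    unfolding c_def d_def by (rule toeplitz_starlike_B[OF f W w(3)]) (rule w(4))
  ultimately show ?thesis
    using norm_triangle_ineq4[of "(c / 2)\<^sup>2" "(3 / 8 * c\<^sup>2 - d / 4)\<^sup>2"] by simp
qed

lemma toeplitz_extremal:
  "\<exists>f\<in>starlike_B. norm (toeplitz_2_1 (inverse_log_coeff f)) = 25 / 64"
proof -
  define k where "k = (\<lambda>z. B_fun (\<i> * z))"
  have khol: "k holomorphic_on unit_disc"
    unfolding k_def
    by (rule holomorphic_on_compose_gen[OF _ B_fun_holomorphic, unfolded o_def])
      (auto intro!: holomorphic_intros simp: norm_mult)
  \<comment> \<open>\<open>f = z exp(h)\<close> has \<open>z f' / f = 1 + z h'\<close>, so \<open>h\<close> is a primitive of \<open>(k - 1) / z\<close>.\<close>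
  define p where "p = (\<lambda>z. if z = 0 then deriv k 0 else (k z - k 0) / (z - 0))"
  have "p holomorphic_on unit_disc"
    unfolding p_def by (rule pole_lemma_open[OF khol]) simp
  then obtain h where h: "\<And>z. z \<in> unit_disc \<Longrightarrow> (h has_field_derivative p z) (at z within unit_disc)"
    using holomorphic_convex_primitive'[of unit_disc p] by auto
  have hd: "(h has_field_derivative p z) (at z)" if "z \<in> unit_disc" for z
    using h[OF that] that at_within_open[of z unit_disc] by simp
  \<comment> \<open>Subtracting \<open>h 0\<close> makes the exponential equal to 1 at the origin,
    which yields the normalization f'(0) = 1.\<close>
  define f where "f = (\<lambda>z. z * exp (h z - h 0))"
  have fd: "(f has_field_derivative exp (h z - h 0) * (1 + z * p z)) (at z)" if "z \<in> unit_disc" for z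
    unfolding f_def
    by (rule derivative_eq_intros hd[OF that] refl | simp add: algebra_simps)+
  have f0: "f 0 = 0"
    by (simp add: f_def)
  have "f holomorphic_on unit_disc"
    using fd by (meson holomorphic_on_open open_ball)
  then have f: "f \<in> class_A"
    using DERIV_imp_deriv[OF fd[of 0]] by (simp add: class_A_def f0)
  have k0: "k 0 = 1"
    by (simp add: k_def B_fun_def)
  have quot: "starlike_quotient f z = k z" if "z \<in> unit_disc" for z
  proof (cases "z = 0")
    case True
    then show ?thesis
      by (simp add: starlike_quotient_def k0)
  next
    case False
    then show ?thesis
      using DERIV_imp_deriv[OF fd[OF that]]
      by (simp add: starlike_quotient_def f_def p_def k0)
  qed
  have "starlike_quotient f holomorphic_on unit_disc"
    by (rule holomorphic_transform[OF khol]) (simp add: quot)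
  then have "subordinate (starlike_quotient f) B_fun"
    unfolding subordinate_def
    using quot B_fun_holomorphic
    by (intro conjI exI[of _ "\<lambda>z. \<i> * z"]) (auto intro!: holomorphic_intros simp: k_def norm_mult)
  then have mem: "f \<in> starlike_B"
    using f by (simp add: starlike_B_def f_def)
  have "(\<lambda>z. \<i> * z) has_fps_expansion fps_const \<i> * fps_X"
    by (intro fps_expansion_intros)
  from toeplitz_starlike_B[OF f this] quot
  \<comment> \<open>With c = \<i> and d = 0 the two squares are -1/4 and 9/64, so their difference
    is -1/4 - 9/64.\<close>
  have "toeplitz_2_1 (inverse_log_coeff f) = of_real (- 25 / 64)"
    by (simp add: k_def power2_eq_square)
  then have "norm (toeplitz_2_1 (inverse_log_coeff f)) = \<bar>- 25 / 64 :: real\<bar>"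
    by (metis norm_of_real)
  with mem show ?thesis
    by auto
qed

theorem theorem4p5:
  shows "(\<forall>f\<in>starlike_B. norm (toeplitz_2_1 (inverse_log_coeff f)) \<le> 25 / 64) \<and>
         (\<exists>f\<in>starlike_B. norm (toeplitz_2_1 (inverse_log_coeff f)) = 25 / 64)"
  using toeplitz_bound toeplitz_extremal by blast

end
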